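(* Let $p>3$ be a prime and let $a,b$ be rationals with denominators not divisible by $p$ such that $p\nmid ab$. Then $$\sum_{k=0}^{[p/3]}\binom{3k}k\frac{b^{2k}}{a^k}\equiv\begin{cases}(-3a)^{[p/3]+1}\,U_{\frac{p-(\frac p3)}3-1}(9b,3a)\pmod p&\text{if }\big(\frac{81b^2-12a}p\big)=1,\\ -(-3a)^{[p/3]}\,U_{\frac{p-(\frac p3)}3+1}(9b,3a)\pmod p&\text{if }\big(\frac{81b^2-12a}p\big)=-1.\end{cases}$$
   Context: $[x]$ is the greatest integer not exceeding $x$. The Lucas sequence $U_n(P,Q)$ is defined by $U_0=0$, $U_1=1$, $U_{n+1}=PU_n-QU_{n-1}$ for $n\ge1$. $\big(\frac p3\big)$ is the Legendre symbol ($=1$ if $p\equiv1\pmod3$, $-1$ if $p\equiv2\pmod 3$); for a rational $r$ with denominator prime to $p$, $\big(\frac rp\big)$ is the Legendre symbol of its residue mod $p$. Congruences are in the ring of rationals with denominator prime to $p$. *)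

theory Defs
  imports Complex_Main "HOL-Number_Theory.Number_Theory"
begin

definition p_integers :: "nat \<Rightarrow> rat set" where
  "p_integers p = {r. \<not> int p dvd snd (quotient_of r)}"

definition rat_cong :: "nat \<Rightarrow> rat \<Rightarrow> rat \<Rightarrow> bool" where
  "rat_cong p x y \<longleftrightarrow> x \<in> p_integers p \<and> y \<in> p_integers p \<and>
     (\<exists>z \<in> p_integers p. x - y = of_nat p * z)"

text \<open>The residue is the representative in $[0,p)$; it is uniquely determined when
  \<open>p\<close> is prime and \<open>r \<in> p_integers p\<close>, and unspecified otherwise.\<close>

definition rat_residue :: "nat \<Rightarrow> rat \<Rightarrow> int" where
  "rat_residue p r = (THE n. 0 \<le> n \<and> n < int p \<and> rat_cong p r (of_int n))"

definition rat_Legendre :: "rat \<Rightarrow> nat \<Rightarrow> int" where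
  "rat_Legendre r p = Legendre (rat_residue p r) (int p)"

fun lucas_U :: "nat \<Rightarrow> 'a::comm_ring_1 \<Rightarrow> 'a \<Rightarrow> 'a" where
  "lucas_U 0 P Q = 0"
| "lucas_U (Suc 0) P Q = 1"
| "lucas_U (Suc (Suc n)) P Q = P * lucas_U (Suc n) P Q - Q * lucas_U n P Q"

end

theory Submission
  imports Defs
begin

text \<open>Put \<open>n = p div 3\<close>. For \<open>k \<le> n\<close> one has
  \<open>(3k choose k) \<equiv> (n+k choose 2k) (-27)^k\<close>, because \<open>-n\<close> and \<open>n+1\<close> are the residues of
  \<open>1/3\<close> and \<open>2/3\<close> in some order. Since \<open>U_{2n+1}(P,Q) = \<Sum>k\<le>n. (n+k choose 2k) P^{2k} (-Q)^{n-k}\<close>,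
  the sum times \<open>(-3a)^n\<close> is congruent to \<open>U_{2n+1}(9b,3a)\<close>. With \<open>D = P^2 - 4Q\<close> and
  \<open>\<epsilon> = (D/p)\<close>, the binomial expansion of \<open>(P + \<surd>D)^p\<close> gives \<open>U_p \<equiv> \<epsilon>\<close> and
  \<open>2 U_{p+1} \<equiv> P (1 + \<epsilon>)\<close>, hence \<open>U_{p-\<epsilon>} \<equiv> 0\<close>, and d'Ocagne's identity reflects the index
  \<open>2n+1\<close> to \<open>p - \<epsilon> - (2n+1)\<close>.\<close>

section \<open>Congruences between \<open>p\<close>-integral rationals\<close>

text \<open>The definition looks only at the reduced fraction. Any fraction with denominator prime
  to \<open>p\<close> will do as well, because the reduced denominator divides every other one;
  closure under ring operations then needs no gcd computations.\<close>

lemma p_integers_iff: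
  assumes "prime p"
  shows "r \<in> p_integers p \<longleftrightarrow> (\<exists>c d. \<not> int p dvd d \<and> r = of_int c / of_int d)"
proof
  assume "r \<in> p_integers p"
  then show "\<exists>c d. \<not> int p dvd d \<and> r = of_int c / of_int d"
    unfolding p_integers_def
    by (metis (mono_tags, lifting) mem_Collect_eq prod.collapse quotient_of_div)
next
  assume "\<exists>c d. \<not> int p dvd d \<and> r = of_int c / of_int d"
  then obtain c d where d: "\<not> int p dvd d" and r: "r = of_int c / of_int d" by blast
  obtain x y where xy: "quotient_of r = (x, y)" by fastforce
  have "y > 0" "coprime x y" "r = of_int x / of_int y"
    using xy quotient_of_denom_pos quotient_of_coprime quotient_of_div by blast+
  moreover have "d \<noteq> 0" using d by auto
  ultimately have "(of_int (c * y) :: rat) = of_int (x * d)"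
    using r by (simp add: field_simps)
  then have "c * y = x * d" by (simp only: of_int_eq_iff)
  then have "y dvd x * d" by (metis dvd_triv_right)
  then have "y dvd d" using \<open>coprime x y\<close>
    by (simp add: coprime_commute coprime_dvd_mult_right_iff)
  then show "r \<in> p_integers p"
    using d xy by (auto simp: p_integers_def)
qed

lemma p_integers_of_int [simp]: "prime p \<Longrightarrow> of_int c \<in> p_integers p"
  by (simp add: p_integers_def not_prime_unit prime_nat_iff)

lemma p_integers_add:
  assumes "prime p" "x \<in> p_integers p" "y \<in> p_integers p"
  shows "x + y \<in> p_integers p"
proof -
  from assms obtain a b c d where *: "\<not> int p dvd b" "x = of_int a / of_int b"
    "\<not> int p dvd d" "y = of_int c / of_int d"
    by (auto simp: p_integers_iff)
  then have "\<not> int p dvd b * d" "b \<noteq> 0" "d \<noteq> 0"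
    using assms(1) by (auto simp: prime_dvd_mult_iff)
  moreover have "x + y = of_int (a * d + c * b) / of_int (b * d)"
    using * \<open>b \<noteq> 0\<close> \<open>d \<noteq> 0\<close> by (simp add: field_simps)
  ultimately show ?thesis using assms(1) p_integers_iff by blast
qed

lemma p_integers_mult:
  assumes "prime p" "x \<in> p_integers p" "y \<in> p_integers p"
  shows "x * y \<in> p_integers p"
proof -
  from assms obtain a b c d where *: "\<not> int p dvd b" "x = of_int a / of_int b"
    "\<not> int p dvd d" "y = of_int c / of_int d"
    by (auto simp: p_integers_iff)
  then have "\<not> int p dvd b * d"
    using assms(1) by (auto simp: prime_dvd_mult_iff)
  moreover have "x * y = of_int (a * c) / of_int (b * d)"
    using * by simp
  ultimately show ?thesis using assms(1) p_integers_iff by blast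
qed

lemma p_integers_of_nat [simp]: "prime p \<Longrightarrow> of_nat c \<in> p_integers p"
  using p_integers_of_int[of p "int c"] by simp

lemma p_integers_numeral [simp]: "prime p \<Longrightarrow> numeral c \<in> p_integers p"
  using p_integers_of_int[of p "numeral c"] by simp

lemma p_integers_0 [simp]: "prime p \<Longrightarrow> 0 \<in> p_integers p"
  using p_integers_of_int[of p 0] by simp

lemma p_integers_1 [simp]: "prime p \<Longrightarrow> 1 \<in> p_integers p"
  using p_integers_of_int[of p 1] by simp

lemma p_integers_uminus: "prime p \<Longrightarrow> x \<in> p_integers p \<Longrightarrow> - x \<in> p_integers p"
  using p_integers_mult[of p "- 1" x] p_integers_of_int[of p "- 1"] by simp

lemma p_integers_diff:
  "prime p \<Longrightarrow> x \<in> p_integers p \<Longrightarrow> y \<in> p_integers p \<Longrightarrow> x - y \<in> p_integers p"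
  using p_integers_add[of p x "- y"] p_integers_uminus[of p y] by simp

lemma p_integers_power: "prime p \<Longrightarrow> x \<in> p_integers p \<Longrightarrow> x ^ k \<in> p_integers p"
  by (induction k) (auto intro: p_integers_mult)

lemmas p_integers_intros =
  p_integers_add p_integers_mult p_integers_uminus p_integers_diff p_integers_power

lemma p_integers_lucas_U:
  "prime p \<Longrightarrow> P \<in> p_integers p \<Longrightarrow> Q \<in> p_integers p \<Longrightarrow> lucas_U n P Q \<in> p_integers p"
  by (induction n P Q rule: lucas_U.induct) (auto intro!: p_integers_intros)

lemma rat_cong_refl: "prime p \<Longrightarrow> x \<in> p_integers p \<Longrightarrow> rat_cong p x x"
  unfolding rat_cong_def by (auto intro: bexI[of _ 0])

lemma rat_cong_sym: "prime p \<Longrightarrow> rat_cong p x y \<Longrightarrow> rat_cong p y x"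
  unfolding rat_cong_def
  by (metis minus_diff_eq mult_minus_right p_integers_uminus)

lemma rat_cong_add:
  assumes "prime p" "rat_cong p x y" "rat_cong p x' y'"
  shows "rat_cong p (x + x') (y + y')"
proof -
  from assms obtain z z' where "z \<in> p_integers p" "x - y = of_nat p * z"
    "z' \<in> p_integers p" "x' - y' = of_nat p * z'"
    unfolding rat_cong_def by blast
  then have "z + z' \<in> p_integers p" "x + x' - (y + y') = of_nat p * (z + z')"
    using assms(1) by (auto intro: p_integers_add simp: algebra_simps)
  with assms show ?thesis
    unfolding rat_cong_def by (blast intro: p_integers_add)
qed

lemma rat_cong_mult:
  assumes "prime p" "rat_cong p x y" "rat_cong p x' y'"
  shows "rat_cong p (x * x') (y * y')"
proof -
  from assms obtain z z' where z: "z \<in> p_integers p" "x - y = of_nat p * z"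
    "z' \<in> p_integers p" "x' - y' = of_nat p * z'"
    unfolding rat_cong_def by blast
  have "x * x' - y * y' = (x - y) * x' + y * (x' - y')"
    by (simp add: algebra_simps)
  also have "\<dots> = of_nat p * (z * x' + y * z')"
    unfolding z by (simp add: algebra_simps)
  finally show ?thesis
    using assms z unfolding rat_cong_def by (blast intro: p_integers_intros)
qed

lemma rat_cong_trans [trans]:
  assumes "rat_cong p x y" "rat_cong p y z" "prime p"
  shows "rat_cong p x z"
  \<comment> \<open>Adding the congruences gives \<open>x + y\<close> against \<open>y + z\<close>,
    and the difference of these is \<open>x - z\<close>.\<close>
  using rat_cong_add[OF assms(3,1,2)] assms unfolding rat_cong_def
  by (simp add: algebra_simps)

lemma rat_cong_uminus: "prime p \<Longrightarrow> rat_cong p x y \<Longrightarrow> rat_cong p (- x) (- y)"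
  using rat_cong_mult[of p "- 1" "- 1" x y] rat_cong_refl[of p "- 1"] p_integers_of_int[of p "- 1"]
  by simp

lemma rat_cong_diff:
  "prime p \<Longrightarrow> rat_cong p x y \<Longrightarrow> rat_cong p x' y' \<Longrightarrow> rat_cong p (x - x') (y - y')"
  using rat_cong_add[of p x y "- x'" "- y'"] rat_cong_uminus[of p x' y'] by simp

lemma rat_cong_power: "prime p \<Longrightarrow> rat_cong p x y \<Longrightarrow> rat_cong p (x ^ k) (y ^ k)"
  by (induction k) (auto intro: rat_cong_mult rat_cong_refl)

lemma rat_cong_sum:
  "prime p \<Longrightarrow> (\<And>i. i \<in> I \<Longrightarrow> rat_cong p (f i) (g i)) \<Longrightarrow> rat_cong p (sum f I) (sum g I)"
  by (induction I rule: infinite_finite_induct) (auto intro: rat_cong_add rat_cong_refl)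

lemma rat_cong_of_int:
  assumes "prime p" "[c = d] (mod int p)"
  shows "rat_cong p (of_int c) (of_int d)"
proof -
  from assms obtain k where "c - d = int p * k"
    by (auto simp: cong_iff_dvd_diff)
  then have "(of_int (c - d) :: rat) = of_int (int p * k)" by (simp only:)
  then show ?thesis
    using assms(1) unfolding rat_cong_def by (auto intro!: bexI[of _ "of_int k"])
qed

lemma rat_cong_0_mult: "prime p \<Longrightarrow> z \<in> p_integers p \<Longrightarrow> rat_cong p (of_nat p * z) 0"
  unfolding rat_cong_def by (auto intro: p_integers_mult)

text \<open>A quotient \<open>x / y\<close> with \<open>p\<close> not dividing \<open>y\<close> can
  be cleared, so the wider ring identifies no further integers modulo \<open>p\<close>. This makes
  residues unique.\<close>

lemma rat_cong_of_int_imp_cong: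
  assumes "prime p" "rat_cong p (of_int c) (of_int d)"
  shows "[c = d] (mod int p)"
proof -
  from assms obtain z where "z \<in> p_integers p" "of_int c - of_int d = of_nat p * z"
    unfolding rat_cong_def by blast
  then obtain x y where *: "\<not> int p dvd y" "of_int c - of_int d = of_nat p * (of_int x / of_int y :: rat)"
    using assms(1) p_integers_iff by metis
  moreover have "y \<noteq> 0" using * by auto
  ultimately have "(of_int ((c - d) * y) :: rat) = of_int (int p * x)"
    by (simp add: field_simps)
  then have "(c - d) * y = int p * x" by (simp only: of_int_eq_iff)
  then have "int p dvd (c - d) * y" by simp
  then show ?thesis using * assms(1)
    by (auto simp: prime_dvd_mult_iff cong_iff_dvd_diff)
qed

section \<open>Inverses and cancellation modulo \<open>p\<close>\<close>

lemma inverse_p_integers: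
  assumes "prime p" "x \<in> p_integers p" "\<not> rat_cong p x 0"
  shows "inverse x \<in> p_integers p"
proof -
  from assms obtain c d where x: "\<not> int p dvd d" "x = of_int c / of_int d"
    by (auto simp: p_integers_iff)
  \<comment> \<open>A numerator divisible by \<open>p\<close> would make \<open>x\<close> a multiple
    of \<open>p\<close>, hence congruent to 0.\<close>
  have "\<not> int p dvd c"
  proof
    assume "int p dvd c"
    then obtain e where "c = int p * e" by blast
    then have "x = of_nat p * (of_int e / of_int d)" using x by simp
    moreover have "of_int e / of_int d \<in> p_integers p"
      using x assms(1) p_integers_iff by blast
    ultimately show False using assms rat_cong_0_mult by blast
  qed
  moreover have "inverse x = of_int d / of_int c" using x by simp
  ultimately show ?thesis using assms(1) p_integers_iff by blast
qed

lemma inverse_of_int_p_integers: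
  assumes "prime p" "\<not> int p dvd d"
  shows "inverse (of_int d) \<in> p_integers p"
proof -
  have "inverse (of_int d) = of_int 1 / (of_int d :: rat)" by (simp add: inverse_eq_divide)
  then show ?thesis using assms p_integers_iff by blast
qed

lemma inverse_2_p_integers:
  assumes "prime p" "p > 2"
  shows "inverse 2 \<in> p_integers p"
proof -
  have "\<not> int p dvd 2" using assms(2) by (auto dest: zdvd_imp_le)
  then show ?thesis using assms(1) inverse_of_int_p_integers[of p 2] by simp
qed

lemma inverse_power_p_integers:
  "prime p \<Longrightarrow> inverse x \<in> p_integers p \<Longrightarrow> inverse (x ^ n) \<in> p_integers p"
  by (simp add: power_inverse[symmetric] p_integers_power)

lemma rat_cong_cancel:
  assumes "prime p" "u \<noteq> 0" "inverse u \<in> p_integers p" "rat_cong p (u * x) (u * y)"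
  shows "rat_cong p x y"
  using rat_cong_mult[OF assms(1) rat_cong_refl[OF assms(1,3)] assms(4)] assms(2)
  by (simp add: mult.assoc[symmetric])

section \<open>Residues, Euler's criterion and Fermat's little theorem for \<open>p\<close>-integral
  rationals\<close>

lemma rat_cong_residue_exists:
  assumes "prime p" "r \<in> p_integers p"
  shows "\<exists>n. 0 \<le> n \<and> n < int p \<and> rat_cong p r (of_int n)"
proof -
  from assms obtain c d where r: "\<not> int p dvd d" "r = of_int c / of_int d"
    by (auto simp: p_integers_iff)
  have "coprime d (int p)"
    using r assms(1) by (metis coprime_commute prime_imp_coprime prime_nat_int_transfer)
  \<comment> \<open>\<open>e\<close> inverts the denominator modulo \<open>p\<close>, so
    \<open>c * e\<close> represents the fraction \<open>c / d\<close>.\<close>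
  then obtain e where e: "[d * e = 1] (mod int p)"
    using cong_solve_coprime_int by blast
  define n where "n = c * e mod int p"
  have "[d * n = d * (c * e)] (mod int p)"
    unfolding n_def by (intro cong_mult) (auto simp: cong_def)
  also have "d * (c * e) = d * e * c" by simp
  also have "[d * e * c = 1 * c] (mod int p)"
    using e by (intro cong_mult) auto
  finally have "[c = d * n] (mod int p)" by (simp add: cong_sym)
  then have "rat_cong p (of_int c) (of_int (d * n))"
    using assms(1) rat_cong_of_int by blast
  moreover have "d \<noteq> 0" using r by auto
  moreover have "inverse (of_int d) \<in> p_integers p"
    using r assms(1) inverse_of_int_p_integers by blast
  ultimately have "rat_cong p r (of_int n)"
    using assms(1) r by (auto intro: rat_cong_cancel[of p "of_int d"])
  moreover have "0 \<le> n" "n < int p"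
    using assms(1) prime_gt_0_nat[of p] by (auto simp: n_def)
  ultimately show ?thesis by blast
qed

text \<open>Existence and uniqueness together justify the definite description behind
  \<open>rat_residue\<close>.\<close>

lemma rat_cong_rat_residue:
  assumes "prime p" "r \<in> p_integers p"
  shows "rat_cong p r (of_int (rat_residue p r))"
proof -
  have "\<exists>!n. 0 \<le> n \<and> n < int p \<and> rat_cong p r (of_int n)"
  proof (rule ex_ex1I)
    show "\<exists>n. 0 \<le> n \<and> n < int p \<and> rat_cong p r (of_int n)"
      using assms rat_cong_residue_exists by blast
  next
    fix m n
    assume *: "0 \<le> m \<and> m < int p \<and> rat_cong p r (of_int m)"
      "0 \<le> n \<and> n < int p \<and> rat_cong p r (of_int n)"
    then have "[m = n] (mod int p)"
      by (meson assms(1) rat_cong_of_int_imp_cong rat_cong_sym rat_cong_trans)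
    with * show "m = n" by (simp add: cong_def)
  qed
  from theI'[OF this] show ?thesis by (simp add: rat_residue_def)
qed

lemma rat_euler_criterion:
  assumes "prime p" "p > 2" "r \<in> p_integers p"
  shows "rat_cong p (r ^ ((p - 1) div 2)) (of_int (rat_Legendre r p))"
proof -
  have "[rat_Legendre r p = rat_residue p r ^ ((p - 1) div 2)] (mod int p)"
    unfolding rat_Legendre_def using assms euler_criterion by blast
  then have "rat_cong p (of_int (rat_residue p r ^ ((p - 1) div 2))) (of_int (rat_Legendre r p))"
    using assms(1) by (intro rat_cong_of_int) (auto simp: cong_sym)
  moreover have "rat_cong p (r ^ ((p - 1) div 2)) (of_int (rat_residue p r ^ ((p - 1) div 2)))"
    unfolding of_int_power using assms by (intro rat_cong_power rat_cong_rat_residue)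
  ultimately show ?thesis using assms(1) rat_cong_trans by blast
qed

lemma rat_fermat_little:
  assumes "prime p" "r \<in> p_integers p"
  shows "rat_cong p (r ^ p) r"
proof -
  \<comment> \<open>A nonnegative representative reduces the claim to Fermat's theorem for naturals;
    the form \<open>r ^ p\<close> also covers residue 0.\<close>
  obtain n :: nat where n: "rat_cong p r (of_nat n)"
    using rat_cong_residue_exists[OF assms] by (metis of_int_of_nat_eq zero_le_imp_eq_int)
  have "[n ^ p = n] (mod p)"
  proof (cases "p dvd n")
    case True
    then have "p dvd n ^ p" using assms(1) prime_gt_0_nat by (simp add: dvd_power_iff prime_dvd_power_iff)
    with True show ?thesis by (simp add: cong_def)
  next
    case False
    then have "[n ^ (p - 1) = 1] (mod p)"
      using assms(1) fermat_theorem by blast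
    then have "[n ^ (p - 1) * n = 1 * n] (mod p)" by (intro cong_mult) auto
    moreover have "n ^ (p - 1) * n = n ^ p"
      using assms(1) prime_gt_0_nat power_minus_mult by blast
    ultimately show ?thesis by simp
  qed
  then have "rat_cong p (of_nat n ^ p) (of_nat n)"
    using rat_cong_of_int[OF assms(1), of "int n ^ p" "int n"] cong_int_iff[of "n ^ p" n p] by simp
  moreover have "rat_cong p (r ^ p) (of_nat n ^ p)"
    using assms n by (intro rat_cong_power)
  ultimately show ?thesis using assms(1) n
    by (meson rat_cong_sym rat_cong_trans)
qed

section \<open>Lucas sequences\<close>

text \<open>Raising \<open>m\<close> by one and expanding both new terms by the recurrence, the
  products carrying \<open>P\<close> cancel and \<open>Q\<close> times the previous right-hand side
  remains.\<close>

lemma lucas_U_d_Ocagne: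
  "Q ^ m * lucas_U j P Q =
     lucas_U (m + j) P Q * lucas_U (Suc m) P Q - lucas_U (Suc (m + j)) P Q * lucas_U m P Q"
  for P Q :: "'a::comm_ring_1"
proof (induction m)
  case (Suc m)
  have "Q ^ Suc m * lucas_U j P Q =
      Q * (lucas_U (m + j) P Q * lucas_U (Suc m) P Q - lucas_U (Suc (m + j)) P Q * lucas_U m P Q)"
    using Suc.IH by (simp add: mult.assoc)
  then show ?case by (simp add: algebra_simps)
qed simp

section \<open>The expansion of \<open>(P + sqrt D)^n\<close> and its link with Lucas
  numbers\<close>

text \<open>Pascal's rule for a binomial sum with arbitrary weights \<open>f\<close>. With weights
  supported on one parity it yields the recurrences of both the rational part and the coefficient of
  \<open>sqrt D\<close>.\<close>

lemma sum_binomial_Suc: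
  fixes x :: "'a::comm_ring_1"
  shows "(\<Sum>k\<le>Suc n. of_nat (Suc n choose k) * x ^ (Suc n - k) * f k) =
     x * (\<Sum>k\<le>n. of_nat (n choose k) * x ^ (n - k) * f k) +
     (\<Sum>k\<le>n. of_nat (n choose k) * x ^ (n - k) * f (Suc k))"
proof -
  have "(\<Sum>k\<le>Suc n. of_nat (Suc n choose k) * x ^ (Suc n - k) * f k) =
      x ^ Suc n * f 0 + (\<Sum>k\<le>n. of_nat (Suc n choose Suc k) * x ^ (n - k) * f (Suc k))"
    by (subst sum.atMost_Suc_shift) simp
  also have "\<dots> = x ^ Suc n * f 0 + (\<Sum>k\<le>n. of_nat (n choose Suc k) * x ^ (n - k) * f (Suc k))
      + (\<Sum>k\<le>n. of_nat (n choose k) * x ^ (n - k) * f (Suc k))"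
    by (simp add: algebra_simps sum.distrib)
  also have "x ^ Suc n * f 0 + (\<Sum>k\<le>n. of_nat (n choose Suc k) * x ^ (n - k) * f (Suc k))
      = (\<Sum>k\<le>Suc n. of_nat (n choose k) * x ^ (Suc n - k) * f k)"
    by (subst sum.atMost_Suc_shift) simp
  also have "\<dots> = (\<Sum>k\<le>n. of_nat (n choose k) * x ^ (Suc n - k) * f k)"
    by (simp add: binomial_eq_0)
  also have "\<dots> = x * (\<Sum>k\<le>n. of_nat (n choose k) * x ^ (n - k) * f k)"
    unfolding sum_distrib_left by (intro sum.cong) (auto simp: Suc_diff_le algebra_simps)
  finally show ?thesis .
qed

text \<open>\<open>(P + \<surd>D)^n = sqrt_even P D n + sqrt_odd P D n * \<surd>D\<close>\<close>

definition sqrt_even :: "'a::comm_ring_1 \<Rightarrow> 'a \<Rightarrow> nat \<Rightarrow> 'a" where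
  "sqrt_even P D n =
     (\<Sum>k\<le>n. of_nat (n choose k) * P ^ (n - k) * (if even k then D ^ (k div 2) else 0))"

definition sqrt_odd :: "'a::comm_ring_1 \<Rightarrow> 'a \<Rightarrow> nat \<Rightarrow> 'a" where
  "sqrt_odd P D n =
     (\<Sum>k\<le>n. of_nat (n choose k) * P ^ (n - k) * (if odd k then D ^ (k div 2) else 0))"

lemma sqrt_even_Suc: "sqrt_even P D (Suc n) = P * sqrt_even P D n + D * sqrt_odd P D n"
proof -
  \<comment> \<open>The shift swaps parities, and \<open>Suc k div 2 = k div 2 + 1\<close> for odd
    \<open>k\<close> supplies the factor \<open>D\<close>.\<close>
  have "(\<Sum>k\<le>n. of_nat (n choose k) * P ^ (n - k) * (if even (Suc k) then D ^ (Suc k div 2) else 0))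
      = D * sqrt_odd P D n"
    unfolding sqrt_odd_def sum_distrib_left
    by (intro sum.cong) (auto elim!: oddE simp: algebra_simps)
  then show ?thesis unfolding sqrt_even_def sum_binomial_Suc by simp
qed

lemma sqrt_odd_Suc: "sqrt_odd P D (Suc n) = P * sqrt_odd P D n + sqrt_even P D n"
proof -
  have "(\<Sum>k\<le>n. of_nat (n choose k) * P ^ (n - k) * (if odd (Suc k) then D ^ (Suc k div 2) else 0))
      = sqrt_even P D n"
    unfolding sqrt_even_def by (intro sum.cong) (auto elim!: evenE)
  then show ?thesis unfolding sqrt_odd_def sum_binomial_Suc by simp
qed

text \<open>Binet's formula without division: \<open>U_n\<close> is the difference of the
  \<open>n\<close>-th powers of \<open>(P + sqrt D)/2\<close> and \<open>(P - sqrt D)/2\<close>,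
  divided by \<open>sqrt D\<close>. In that difference the even parts cancel and the odd parts
  double.\<close>

lemma lucas_U_eq_sqrt_odd: "2 ^ n * lucas_U n P Q = 2 * sqrt_odd P (P\<^sup>2 - 4 * Q) n"
proof (induction n P Q rule: lucas_U.induct)
  case (3 n P Q)
  let ?A = "sqrt_even P (P\<^sup>2 - 4 * Q) n" and ?B = "sqrt_odd P (P\<^sup>2 - 4 * Q) n"
  have "2 ^ Suc (Suc n) * lucas_U (Suc (Suc n)) P Q =
      2 * P * (2 ^ Suc n * lucas_U (Suc n) P Q) - 4 * Q * (2 ^ n * lucas_U n P Q)"
    by (simp add: algebra_simps)
  also have "\<dots> = 2 * P * (2 * (P * ?B + ?A)) - 4 * Q * (2 * ?B)"
    by (simp only: 3 sqrt_odd_Suc)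
  also have "\<dots> = 2 * sqrt_odd P (P\<^sup>2 - 4 * Q) (Suc (Suc n))"
    by (simp add: sqrt_odd_Suc sqrt_even_Suc algebra_simps power2_eq_square)
  finally show ?case .
qed (simp_all add: sqrt_odd_def)

section \<open>Lucas numbers near a prime index, modulo that prime\<close>

text \<open>The prime \<open>p\<close> divides every inner binomial coefficient, so only the two end
  terms survive.\<close>

lemma rat_cong_binomial_sum_prime:
  assumes "prime p" "x \<in> p_integers p" "\<And>k. f k \<in> p_integers p"
  shows "rat_cong p (\<Sum>k\<le>p. of_nat (p choose k) * x ^ (p - k) * f k) (x ^ p * f 0 + f p)"
proof -
  obtain q where q: "p = Suc q"
    using assms(1) prime_gt_0_nat gr0_implies_Suc by blast
  have "rat_cong p (of_nat (p choose Suc k) * x ^ (p - Suc k) * f (Suc k)) 0" if "k < q" for k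
  proof -
    have "p dvd (p choose Suc k)"
      using that assms(1) q by (intro dvd_choose_prime) auto
    then obtain c where "(p choose Suc k) = p * c" by blast
    then have "of_nat (p choose Suc k) * x ^ (p - Suc k) * f (Suc k) =
        of_nat p * (of_nat c * x ^ (p - Suc k) * f (Suc k))" by simp
    then show ?thesis
      using assms by (simp only:) (intro rat_cong_0_mult p_integers_intros, auto)
  qed
  then have "rat_cong p (\<Sum>k<q. of_nat (p choose Suc k) * x ^ (p - Suc k) * f (Suc k)) (\<Sum>k<q. 0)"
    using assms(1) by (intro rat_cong_sum) auto
  then have "rat_cong p (x ^ p * f 0 +
      (\<Sum>k<q. of_nat (p choose Suc k) * x ^ (p - Suc k) * f (Suc k)) + f p) (x ^ p * f 0 + 0 + f p)"
    using assms by (intro rat_cong_add rat_cong_refl p_integers_intros) auto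
  moreover have "(\<Sum>k\<le>p. of_nat (p choose k) * x ^ (p - k) * f k) = x ^ p * f 0 +
      (\<Sum>k<q. of_nat (p choose Suc k) * x ^ (p - Suc k) * f (Suc k)) + f p"
    unfolding q lessThan_Suc_atMost[symmetric]
    by (subst sum.lessThan_Suc_shift) simp
  ultimately show ?thesis by simp
qed

text \<open>As \<open>p\<close> is odd, the odd part of \<open>(P + sqrt D)^p\<close> keeps only
  \<open>D ^ ((p - 1) div 2)\<close>, which Euler's criterion evaluates, and the even part keeps
  only \<open>P ^ p\<close>, which Fermat reduces to \<open>P\<close>.\<close>

lemma lucas_U_prime_cong:
  assumes "prime p" "p > 2" "P \<in> p_integers p" "Q \<in> p_integers p"
  defines "\<epsilon> \<equiv> of_int (rat_Legendre (P\<^sup>2 - 4 * Q) p)"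
  shows "rat_cong p (lucas_U p P Q) \<epsilon>"
    and "rat_cong p (2 * lucas_U (Suc p) P Q) (P * (1 + \<epsilon>))"
proof -
  note [simp] = assms(1)
  define D where "D = P\<^sup>2 - 4 * Q"
  have D: "D \<in> p_integers p"
    unfolding D_def using assms by (intro p_integers_intros) auto
  have "odd p" using assms prime_odd_nat by blast
  have inv2: "inverse 2 \<in> p_integers p" using assms inverse_2_p_integers by blast
  have "rat_cong p (sqrt_odd P D p) (P ^ p * (if odd (0::nat) then D ^ (0 div 2) else 0) +
      (if odd p then D ^ (p div 2) else 0))"
    unfolding sqrt_odd_def using assms D
    by (intro rat_cong_binomial_sum_prime) (auto intro: p_integers_intros)
  also have "\<dots> = D ^ ((p - 1) div 2)" using \<open>odd p\<close> by (auto elim: oddE)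
  also have "rat_cong p \<dots> \<epsilon>"
    unfolding \<epsilon>_def D_def[symmetric] using assms D by (intro rat_euler_criterion) auto
  finally have B: "rat_cong p (sqrt_odd P D p) \<epsilon>" by simp
  have "rat_cong p (sqrt_even P D p) (P ^ p * (if even (0::nat) then D ^ (0 div 2) else 0) +
      (if even p then D ^ (p div 2) else 0))"
    unfolding sqrt_even_def using assms D
    by (intro rat_cong_binomial_sum_prime) (auto intro: p_integers_intros)
  also have "\<dots> = P ^ p" using \<open>odd p\<close> by simp
  also have "rat_cong p \<dots> P" using assms by (intro rat_fermat_little)
  finally have A: "rat_cong p (sqrt_even P D p) P" by simp
  \<comment> \<open>This trades the factor \<open>2 ^ p\<close> in
    \<open>lucas_U_eq_sqrt_odd\<close> for 2.\<close>
  have fermat2: "rat_cong p 2 (2 ^ p)"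
    by (rule rat_cong_sym) (auto intro: rat_fermat_little)
  have U: "lucas_U k P Q \<in> p_integers p" for k
    using assms by (intro p_integers_lucas_U)
  have "rat_cong p (2 * lucas_U p P Q) (2 ^ p * lucas_U p P Q)"
    using U by (intro rat_cong_mult fermat2 rat_cong_refl) auto
  also have "\<dots> = 2 * sqrt_odd P D p" by (simp add: lucas_U_eq_sqrt_odd D_def)
  also have "rat_cong p \<dots> (2 * \<epsilon>)"
    using B by (intro rat_cong_mult rat_cong_refl) auto
  finally show "rat_cong p (lucas_U p P Q) \<epsilon>"
    using rat_cong_cancel[of p 2] inv2 by simp
  \<comment> \<open>The inner 2 completes \<open>2 ^ p\<close> to the power \<open>2 ^ Suc p\<close>
    belonging to index \<open>Suc p\<close>.\<close>
  have "rat_cong p (2 * (2 * lucas_U (Suc p) P Q)) (2 ^ p * (2 * lucas_U (Suc p) P Q))"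
    using U by (intro rat_cong_mult fermat2 rat_cong_refl) (auto intro: p_integers_intros)
  also have "\<dots> = 2 * sqrt_odd P D (Suc p)"
    using lucas_U_eq_sqrt_odd[of "Suc p" P Q] by (simp add: D_def)
  also have "\<dots> = 2 * (P * sqrt_odd P D p + sqrt_even P D p)" by (simp add: sqrt_odd_Suc)
  also have "rat_cong p \<dots> (2 * (P * \<epsilon> + P))"
    using A B assms by (intro rat_cong_mult rat_cong_add rat_cong_refl) auto
  finally have "rat_cong p (2 * lucas_U (Suc p) P Q) (P * \<epsilon> + P)"
    using rat_cong_cancel[of p 2] inv2 by simp
  then show "rat_cong p (2 * lucas_U (Suc p) P Q) (P * (1 + \<epsilon>))"
    by (simp add: algebra_simps)
qed

section \<open>Lucas numbers as explicit binomial sums\<close>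

text \<open>Both parities are proved in one induction, since the recurrence for either index uses
  the other. Pascal's rule splits each coefficient into the part from \<open>P * U\<close> and the
  part from \<open>- Q * U\<close>.\<close>

lemma lucas_U_binomial_sum:
  fixes P Q :: "'a::comm_ring_1"
  shows "lucas_U (2 * n + 1) P Q =
           (\<Sum>k\<le>n. of_nat ((n + k) choose (2 * k)) * P ^ (2 * k) * (- Q) ^ (n - k))"
    and "lucas_U (2 * n + 2) P Q =
           (\<Sum>k\<le>n. of_nat ((n + k + 1) choose (2 * k + 1)) * P ^ (2 * k + 1) * (- Q) ^ (n - k))"
proof (induction n)
  case 0
  case 1 show ?case by simp
  case 2 show ?case by simp
next
  case (Suc n)
  have odd: "lucas_U (2 * Suc n + 1) P Q =
      (\<Sum>k\<le>Suc n. of_nat ((Suc n + k) choose (2 * k)) * P ^ (2 * k) * (- Q) ^ (Suc n - k))"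
  proof -
    let ?g = "\<lambda>k. of_nat ((n + k) choose (2 * k)) * P ^ (2 * k) * (- Q) ^ (Suc n - k)"
    have "(\<Sum>k\<le>Suc n. of_nat ((Suc n + k) choose (2 * k)) * P ^ (2 * k) * (- Q) ^ (Suc n - k)) =
        (- Q) ^ Suc n + (\<Sum>k\<le>n. of_nat ((n + k + 1) choose (2 * k + 1)) * P ^ (2 * k + 2) * (- Q) ^ (n - k)
          + ?g (Suc k))"
      by (subst sum.atMost_Suc_shift) (simp add: algebra_simps)
    also have "\<dots> = P * lucas_U (2 * n + 2) P Q + (?g 0 + (\<Sum>k\<le>n. ?g (Suc k)))"
      unfolding Suc.IH(2) sum.distrib sum_distrib_left by (simp add: algebra_simps)
    also have "?g 0 + (\<Sum>k\<le>n. ?g (Suc k)) = (\<Sum>k\<le>Suc n. ?g k)"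
      by (rule sum.atMost_Suc_shift[symmetric])
    \<comment> \<open>The top term vanishes: its coefficient is \<open>2n+1\<close> choose
      \<open>2n+2\<close>.\<close>
    also have "\<dots> = (\<Sum>k\<le>n. ?g k)" by (simp add: binomial_eq_0)
    also have "\<dots> = - Q * lucas_U (2 * n + 1) P Q"
      unfolding Suc.IH(1) sum_distrib_left
      by (intro sum.cong) (auto simp: Suc_diff_le algebra_simps)
    finally show ?thesis by simp
  qed
  have even: "lucas_U (2 * Suc n + 2) P Q =
      (\<Sum>k\<le>Suc n. of_nat ((Suc n + k + 1) choose (2 * k + 1)) * P ^ (2 * k + 1) * (- Q) ^ (Suc n - k))"
  proof -
    let ?g = "\<lambda>k. of_nat ((Suc n + k) choose (2 * k + 1)) * P ^ (2 * k + 1) * (- Q) ^ (Suc n - k)"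
    have "(\<Sum>k\<le>Suc n. of_nat ((Suc n + k + 1) choose (2 * k + 1)) * P ^ (2 * k + 1) * (- Q) ^ (Suc n - k))
        = P * lucas_U (2 * Suc n + 1) P Q + (\<Sum>k\<le>Suc n. ?g k)"
      unfolding odd sum_distrib_left sum.distrib[symmetric]
      by (intro sum.cong refl) (simp add: algebra_simps)
    also have "(\<Sum>k\<le>Suc n. ?g k) = (\<Sum>k\<le>n. ?g k)" by (simp add: binomial_eq_0)
    also have "\<dots> = - Q * lucas_U (2 * n + 2) P Q"
      unfolding Suc.IH(2) sum_distrib_left
      by (intro sum.cong) (auto simp: Suc_diff_le algebra_simps)
    finally show ?thesis by simp
  qed
  case 1 show ?case by (rule odd)
  case 2 show ?case by (rule even)
qed

section \<open>The truncated sum\<close>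

text \<open>The ratio of consecutive coefficients, cleared of denominators; the 3 is
  \<open>(3k+3)/(k+1)\<close>.\<close>

lemma binomial_mult_Suc_3:
  "int ((3 * Suc k) choose Suc k) * int ((2 * k + 1) * (2 * k + 2)) =
     int ((3 * k) choose k) * (3 * (3 * int k + 1) * (3 * int k + 2))"
proof -
  have 1: "fact k * fact (2 * k) * ((3 * k) choose k) = (fact (3 * k) :: nat)"
    using binomial_fact_lemma[of k "3 * k"] by simp
  have 2: "fact (Suc k) * fact (2 * k + 2) * ((3 * Suc k) choose Suc k) = (fact (3 * Suc k) :: nat)"
    using binomial_fact_lemma[of "Suc k" "3 * Suc k"] by (simp add: numeral_eq_Suc)
  have 3: "fact (2 * k + 2) = (2 * k + 2) * (2 * k + 1) * (fact (2 * k) :: nat)"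
    by (simp only: numeral_2_eq_2 One_nat_def add_Suc_right add_0_right fact_Suc of_nat_id mult.assoc)
  have 4: "fact (3 * Suc k) = (3 * k + 3) * (3 * k + 2) * (3 * k + 1) * (fact (3 * k) :: nat)"
  proof -
    have "3 * Suc k = Suc (Suc (Suc (3 * k)))" "3 * k + 3 = Suc (Suc (Suc (3 * k)))"
      "3 * k + 2 = Suc (Suc (3 * k))" "3 * k + 1 = Suc (3 * k)"
      by simp_all
    then show ?thesis by (simp only: fact_Suc of_nat_id mult.assoc)
  qed
  \<comment> \<open>The positive factor \<open>(k + 1) * (fact k * fact (2 * k))\<close> turns both
    sides into factorials and is cancelled at the end.\<close>
  have "(k + 1) * (fact k * fact (2 * k)) *
        (((3 * Suc k) choose Suc k) * ((2 * k + 1) * (2 * k + 2))) =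
      fact (Suc k) * fact (2 * k + 2) * ((3 * Suc k) choose Suc k)"
    unfolding 3 fact_Suc[of k] of_nat_id by (simp only: Suc_eq_plus1 ac_simps)
  also have "\<dots> =
      (3 * k + 3) * (3 * k + 2) * (3 * k + 1) * (fact k * fact (2 * k) * ((3 * k) choose k))"
    unfolding 1 2 4 ..
  also have "\<dots> = (k + 1) * (fact k * fact (2 * k)) *
      (((3 * k) choose k) * (3 * (3 * k + 1) * (3 * k + 2)))"
    by (simp add: algebra_simps)
  finally have "((3 * Suc k) choose Suc k) * ((2 * k + 1) * (2 * k + 2)) =
      ((3 * k) choose k) * (3 * (3 * k + 1) * (3 * k + 2))"
    by (simp only: mult_cancel1) simp
  from arg_cong[OF this, of int] show ?thesis
    by (simp only: of_nat_mult of_nat_add of_nat_numeral of_nat_1)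
qed

text \<open>The factor \<open>(2k+1)(2k+2)\<close> is the one in \<open>binomial_mult_Suc_3\<close>,
  so the two recurrences can be compared directly.\<close>

lemma binomial_mult_Suc_2:
  assumes "k < n"
  shows "int ((n + Suc k) choose (2 * Suc k)) * int ((2 * k + 1) * (2 * k + 2)) =
     int ((n + k) choose (2 * k)) * ((int n + int k + 1) * (int n - int k))"
proof -
  have "n + Suc k = Suc (n + k)" "2 * Suc k = Suc (Suc (2 * k))" "2 * k + 1 = Suc (2 * k)"
    "2 * k + 2 = Suc (Suc (2 * k))"
    by simp_all
  then have "((n + Suc k) choose (2 * Suc k)) * ((2 * k + 1) * (2 * k + 2)) =
      (Suc (Suc (2 * k)) * (Suc (n + k) choose Suc (Suc (2 * k)))) * Suc (2 * k)"
    by (simp only: ac_simps)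
  also have "\<dots> = Suc (n + k) * (Suc (2 * k) * ((n + k) choose Suc (2 * k)))"
    unfolding Suc_times_binomial by (simp only: ac_simps)
  \<comment> \<open>Both sides equal \<open>n+k\<close> times the coefficient \<open>n+k-1\<close>
    choose \<open>2k\<close>.\<close>
  also have "Suc (2 * k) * ((n + k) choose Suc (2 * k)) = (n - k) * ((n + k) choose (2 * k))"
    using assms binomial_absorb_comp[of "n + k" "2 * k"] binomial_absorption[of "2 * k" "n + k"]
    by simp
  finally have "((n + Suc k) choose (2 * Suc k)) * ((2 * k + 1) * (2 * k + 2)) =
      ((n + k) choose (2 * k)) * ((n + k + 1) * (n - k))"
    by (simp only: Suc_eq_plus1 ac_simps)
  from arg_cong[OF this, of int] show ?thesis
    using assms by (simp only: of_nat_mult of_nat_add of_nat_diff less_imp_le of_nat_1)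
qed

text \<open>The only nonzero square modulo 3 is 1. Tying the symbol to the remainder of
  \<open>p\<close> later turns the indices of the theorem into expressions in
  \<open>p div 3\<close>.\<close>

lemma Legendre_3:
  assumes "prime p" "p > 3"
  shows "p = 3 * (p div 3) + 1 \<and> Legendre (int p) 3 = 1 \<or>
    p = 3 * (p div 3) + 2 \<and> Legendre (int p) 3 = - 1"
proof -
  have "p mod 3 \<noteq> 0"
  proof
    assume "p mod 3 = 0"
    then have "3 dvd p" by auto
    then show False
      using assms by (auto simp: prime_nat_iff)
  qed
  then consider "p mod 3 = 1" | "p mod 3 = 2" by linarith
  then show ?thesis
  proof cases
    case 1
    then have "[1\<^sup>2 = int p] (mod 3)" "\<not> [int p = 0] (mod 3)"
      by (auto simp: cong_def) presburger+
    then have "Legendre (int p) 3 = 1" unfolding Legendre_def QuadRes_def by metis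
    with 1 show ?thesis by presburger
  next
    case 2
    have "\<not> [y\<^sup>2 = int p] (mod 3)" for y
    proof -
      have "int p mod 3 = 2" using 2 by presburger
      moreover have "y\<^sup>2 mod 3 = (y mod 3)\<^sup>2 mod 3" by (simp add: power_mod)
      moreover have "y mod 3 = 0 \<or> y mod 3 = 1 \<or> y mod 3 = 2" by presburger
      ultimately show ?thesis by (auto simp: cong_def)
    qed
    moreover have "\<not> [int p = 0] (mod 3)" using 2 by (auto simp: cong_def) presburger
    ultimately have "Legendre (int p) 3 = - 1" unfolding Legendre_def QuadRes_def by auto
    with 2 show ?thesis by presburger
  qed
qed

text \<open>Induction on \<open>k\<close>: both sides satisfy the same first-order recurrence modulo
  \<open>p\<close>.\<close>

lemma binomial_3_cong:
  assumes "prime p" "p > 3" "k \<le> p div 3"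
  shows "[int ((3 * k) choose k) = int ((p div 3 + k) choose (2 * k)) * (- 27) ^ k] (mod int p)"
  using assms(3)
proof (induction k)
  case (Suc k)
  define n where "n = p div 3"
  define d where "d = int ((2 * k + 1) * (2 * k + 2))"
  have k: "k < n" using Suc.prems n_def by simp
  have p: "int p = 3 * int n + 1 \<or> int p = 3 * int n + 2"
    using Legendre_3[OF assms(1,2)] unfolding n_def by linarith
  have c: "[3 * (3 * int k + 1) * (3 * int k + 2) = (int n + int k + 1) * (int n - int k) * (- 27)] (mod int p)"
  proof -
    \<comment> \<open>All terms in \<open>k\<close> cancel in the difference, and \<open>p\<close>
      is one of the two remaining factors \<open>3n+1\<close> and \<open>3n+2\<close>.\<close>
    have "3 * (3 * int k + 1) * (3 * int k + 2) - (int n + int k + 1) * (int n - int k) * (- 27) =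
        3 * (3 * int n + 1) * (3 * int n + 2)"
      by (simp add: algebra_simps)
    moreover have "int p dvd 3 * (3 * int n + 1) * (3 * int n + 2)"
      using p by (metis dvd_triv_left dvd_triv_right dvd_mult2)
    ultimately show ?thesis by (simp only: cong_iff_dvd_diff)
  qed
  have "[int ((3 * k) choose k) * (3 * (3 * int k + 1) * (3 * int k + 2)) =
      int ((n + k) choose (2 * k)) * (- 27) ^ k * ((int n + int k + 1) * (int n - int k) * (- 27))] (mod int p)"
    using Suc c unfolding n_def by (intro cong_mult[OF _ c[unfolded n_def]]) auto
  also have "int ((n + k) choose (2 * k)) * (- 27) ^ k * ((int n + int k + 1) * (int n - int k) * (- 27)) =
      int ((n + k) choose (2 * k)) * ((int n + int k + 1) * (int n - int k)) * (- 27) ^ Suc k"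
    by simp
  finally have "[int ((3 * Suc k) choose Suc k) * d =
      int ((n + Suc k) choose (2 * Suc k)) * (- 27) ^ Suc k * d] (mod int p)"
    unfolding binomial_mult_Suc_3[symmetric] binomial_mult_Suc_2[OF k, symmetric] d_def[symmetric]
    by (simp only: ac_simps)
  moreover have "coprime d (int p)"
  proof -
    \<comment> \<open>Both numbers are positive and at most \<open>2n\<close>, hence below
      \<open>p\<close>.\<close>
    have "\<not> p dvd 2 * k + 1" "\<not> p dvd 2 * k + 2"
      using k p by (auto dest!: dvd_imp_le)
    then have "\<not> p dvd (2 * k + 1) * (2 * k + 2)"
      using assms(1) prime_dvd_mult_iff by blast
    then have "coprime p ((2 * k + 1) * (2 * k + 2))"
      using assms(1) prime_imp_coprime by blast
    then show ?thesis unfolding d_def by (simp only: coprime_int_iff coprime_commute)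
  qed
  ultimately show ?case unfolding n_def using cong_mult_rcancel by blast
qed simp

lemma truncated_sum_cong_lucas_U:
  assumes "prime p" "p > 3" "a \<noteq> 0" "inverse a \<in> p_integers p"
    and "a \<in> p_integers p" "b \<in> p_integers p"
  defines "n \<equiv> p div 3"
  shows "rat_cong p
    ((- 3 * a) ^ n * (\<Sum>k = 0..n. of_nat ((3 * k) choose k) * (b ^ (2 * k) / a ^ k)))
    (lucas_U (2 * n + 1) (9 * b) (3 * a))"
proof -
  note [simp] = assms(1)
  have "rat_cong p (\<Sum>k = 0..n. of_nat ((3 * k) choose k) * (b ^ (2 * k) / a ^ k))
      (\<Sum>k = 0..n. of_int (int ((n + k) choose (2 * k)) * (- 27) ^ k) * (b ^ (2 * k) / a ^ k))"
  proof (intro rat_cong_sum rat_cong_mult)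
    fix k assume "k \<in> {0..n}"
    then show "rat_cong p (of_nat ((3 * k) choose k)) (of_int (int ((n + k) choose (2 * k)) * (- 27) ^ k))"
      using rat_cong_of_int[OF assms(1) binomial_3_cong[OF assms(1,2), of k]]
      unfolding n_def by simp
    show "rat_cong p (b ^ (2 * k) / a ^ k) (b ^ (2 * k) / a ^ k)"
      unfolding divide_inverse power_inverse[symmetric]
      using assms by (intro rat_cong_refl p_integers_mult p_integers_power)
  qed auto
  moreover have "(- 3 * a) ^ n \<in> p_integers p"
    using assms(5) by (auto intro!: p_integers_power p_integers_uminus p_integers_mult)
  ultimately have "rat_cong p
      ((- 3 * a) ^ n * (\<Sum>k = 0..n. of_nat ((3 * k) choose k) * (b ^ (2 * k) / a ^ k)))
      ((- 3 * a) ^ n * (\<Sum>k = 0..n. of_int (int ((n + k) choose (2 * k)) * (- 27) ^ k) * (b ^ (2 * k) / a ^ k)))"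
    using assms(1) by (intro rat_cong_mult rat_cong_refl)
  also have "(- 3 * a) ^ n * (\<Sum>k = 0..n. of_int (int ((n + k) choose (2 * k)) * (- 27) ^ k) * (b ^ (2 * k) / a ^ k))
      = lucas_U (2 * n + 1) (9 * b) (3 * a)"
    unfolding lucas_U_binomial_sum(1) sum_distrib_left atLeast0AtMost
  proof (intro sum.cong refl)
    fix k assume "k \<in> {..n}"
    then have 1: "(- 3 * a) ^ n = (- 3 * a) ^ (n - k) * (- 3 * a) ^ k"
      by (simp add: power_add[symmetric])
    \<comment> \<open>This explains the parameters \<open>9b\<close> and \<open>3a\<close>: the
      product of \<open>-3a\<close>, \<open>-27\<close> and \<open>b^2 / a\<close> is
      \<open>(9b)^2\<close>.\<close>
    have 2: "(- 3 * a) ^ k * ((- 27) ^ k * (b ^ (2 * k) / a ^ k)) = (9 * b) ^ (2 * k)"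
    proof -
      have "(- 3 * a) ^ k * ((- 27) ^ k * (b ^ (2 * k) / a ^ k)) = ((- 3 * a) * ((- 27) * (b\<^sup>2 / a))) ^ k"
        by (simp only: power_mult_distrib power_divide power_mult)
      also have "(- 3 * a) * ((- 27) * (b\<^sup>2 / a)) = (9 * b)\<^sup>2"
        using assms(3) by (simp add: power2_eq_square)
      finally show ?thesis by (simp add: power_mult)
    qed
    have "(- 3 * a) ^ n * ((- 27) ^ k * (b ^ (2 * k) / a ^ k)) =
        (9 * b) ^ (2 * k) * (- 3 * a) ^ (n - k)"
      unfolding 1 2[symmetric] by (simp only: ac_simps)
    then have "of_nat ((n + k) choose (2 * k)) * ((- 3 * a) ^ n * ((- 27) ^ k * (b ^ (2 * k) / a ^ k))) =
        of_nat ((n + k) choose (2 * k)) * ((9 * b) ^ (2 * k) * (- 3 * a) ^ (n - k))"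
      by (simp only:)
    then show "(- 3 * a) ^ n * (of_int (int ((n + k) choose (2 * k)) * (- 27) ^ k) * (b ^ (2 * k) / a ^ k)) =
        of_nat ((n + k) choose (2 * k)) * (9 * b) ^ (2 * k) * (- (3 * a)) ^ (n - k)"
      by (simp add: algebra_simps)
  qed
  finally show ?thesis by simp
qed

section \<open>Reflection of the Lucas index and conclusion\<close>

theorem theorem3p3:
  fixes p :: nat and a b :: rat
  assumes "prime p" and "p > 3"
    and "a \<in> p_integers p" and "b \<in> p_integers p"
    and "\<not> rat_cong p (a * b) 0"
  shows "(rat_Legendre (81 * b^2 - 12 * a) p = 1 \<longrightarrow>
            rat_cong p
              (\<Sum>k = 0..p div 3. of_nat ((3 * k) choose k) * (b ^ (2 * k) / a ^ k))
              ((- 3 * a) ^ (p div 3 + 1) *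
                lucas_U (nat ((int p - Legendre (int p) 3) div 3 - 1)) (9 * b) (3 * a)))
       \<and> (rat_Legendre (81 * b^2 - 12 * a) p = - 1 \<longrightarrow>
            rat_cong p
              (\<Sum>k = 0..p div 3. of_nat ((3 * k) choose k) * (b ^ (2 * k) / a ^ k))
              (- ((- 3 * a) ^ (p div 3)) *
                lucas_U (nat ((int p - Legendre (int p) 3) div 3 + 1)) (9 * b) (3 * a)))"
proof -
  note [simp] = assms(1)
  define n where "n = p div 3"
  define m where "m = 2 * n + 1"
  define S where "S = (\<Sum>k = 0..n. of_nat ((3 * k) choose k) * (b ^ (2 * k) / a ^ k))"
  define P where "P = 9 * b"
  define Q where "Q = 3 * a"
  have P: "P \<in> p_integers p" and Q: "Q \<in> p_integers p"
    unfolding P_def Q_def using assms by (auto intro: p_integers_intros)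
  have U: "lucas_U k P Q \<in> p_integers p" for k
    using P Q by (intro p_integers_lucas_U) auto
  have D: "81 * b\<^sup>2 - 12 * a = P\<^sup>2 - 4 * Q"
    by (simp add: P_def Q_def power2_eq_square)
  have a0: "\<not> rat_cong p a 0"
    using assms rat_cong_mult[of p a 0 b b] rat_cong_refl by auto
  then have "a \<noteq> 0" using rat_cong_refl[of p 0] by auto
  have ia: "inverse a \<in> p_integers p" using a0 assms inverse_p_integers by blast
  have "\<not> int p dvd 3" using assms(2) by (auto dest: zdvd_imp_le)
  then have i3: "inverse 3 \<in> p_integers p"
    using inverse_of_int_p_integers[of p 3] by simp
  have iQ: "inverse Q \<in> p_integers p"
    unfolding Q_def inverse_mult_distrib using ia i3 by (intro p_integers_mult) auto
  then have imQ: "inverse (- Q) \<in> p_integers p"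
    using p_integers_uminus[of p "inverse Q"] by simp
  have "Q \<noteq> 0" using \<open>a \<noteq> 0\<close> by (simp add: Q_def)
  have S: "rat_cong p ((- Q) ^ n * S) (lucas_U m P Q)"
    using truncated_sum_cong_lucas_U[OF assms(1,2) \<open>a \<noteq> 0\<close> ia assms(3,4)]
    unfolding n_def m_def P_def Q_def S_def by simp
  have p: "p = 3 * n + 1 \<or> p = 3 * n + 2"
    using Legendre_3[OF assms(1,2)] unfolding n_def by blast
  \<comment> \<open>The quotient is \<open>n\<close> if \<open>p = 3n+1\<close> and
    \<open>n+1\<close> if \<open>p = 3n+2\<close>; in both cases it equals
    \<open>p - m\<close>.\<close>
  have idx1: "nat ((int p - Legendre (int p) 3) div 3 - 1) = p - 1 - m"
    and idx2: "nat ((int p - Legendre (int p) 3) div 3 + 1) = p + 1 - m"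
    using Legendre_3[OF assms(1,2)] unfolding m_def n_def[symmetric] by auto
  \<comment> \<open>This keeps the natural subtraction \<open>p - 1 - m\<close> from
    truncating.\<close>
  have "n \<ge> 1" using p assms(2) by linarith
  then have le: "m \<le> p - 1" using p by (auto simp: m_def)
  have cancel_2: "rat_cong p x y" if "rat_cong p (2 * x) (2 * y)" for x y
    using rat_cong_cancel[OF assms(1) _ inverse_2_p_integers that] assms(1,2) by simp
  have cancel_Q: "rat_cong p x y" if "rat_cong p (Q * x) (Q * y)" for x y
    using rat_cong_cancel[OF assms(1) \<open>Q \<noteq> 0\<close> iQ that] .
  have cancel_Q_power: "rat_cong p x y" if "rat_cong p ((- Q) ^ n * x) ((- Q) ^ n * y)" for x y
    using rat_cong_cancel[OF assms(1) _ inverse_power_p_integers[OF assms(1) imQ] that] \<open>Q \<noteq> 0\<close>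
    by simp
  have UL: "rat_cong p (lucas_U p P Q) (of_int (rat_Legendre (P\<^sup>2 - 4 * Q) p))"
    "rat_cong p (2 * lucas_U (Suc p) P Q) (P * (1 + of_int (rat_Legendre (P\<^sup>2 - 4 * Q) p)))"
    using lucas_U_prime_cong[OF assms(1) _ P Q] assms(2) by simp_all
  obtain q where q: "p = Suc q" using assms(2) by (cases p) auto
  have "rat_cong p S ((- Q) ^ (n + 1) * lucas_U (p - 1 - m) P Q)"
    if "rat_Legendre (P\<^sup>2 - 4 * Q) p = 1"
  proof -
    have Up: "rat_cong p (lucas_U p P Q) 1"
      and U1: "rat_cong p (2 * lucas_U (Suc p) P Q) (2 * P)"
      using UL unfolding that by (simp_all add: mult.commute)
    from U1 have "rat_cong p (lucas_U (Suc p) P Q) P"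
      by (rule cancel_2)
    \<comment> \<open>The recurrence run backwards: this difference is
      \<open>Q * lucas_U (p - 1) P Q\<close>.\<close>
    then have "rat_cong p (P * lucas_U p P Q - lucas_U (Suc p) P Q) (P * 1 - P)"
      using Up P by (intro rat_cong_diff rat_cong_mult rat_cong_refl) auto
    then have "rat_cong p (Q * lucas_U (p - 1) P Q) (Q * 0)" by (simp add: q)
    then have U0: "rat_cong p (lucas_U (p - 1) P Q) 0"
      by (rule cancel_Q)
    have "Q ^ m * lucas_U (p - 1 - m) P Q =
        lucas_U (p - 1) P Q * lucas_U (Suc m) P Q - lucas_U p P Q * lucas_U m P Q"
      using lucas_U_d_Ocagne[of Q m "p - 1 - m" P] le q by simp
    also have "rat_cong p \<dots> (0 * lucas_U (Suc m) P Q - 1 * lucas_U m P Q)"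
      using Up U0 U by (intro rat_cong_diff rat_cong_mult rat_cong_refl) auto
    finally have "rat_cong p (- (Q ^ m * lucas_U (p - 1 - m) P Q)) (lucas_U m P Q)"
      using rat_cong_uminus[of p _ "- lucas_U m P Q"] by simp
    moreover have "- (Q ^ m * lucas_U (p - 1 - m) P Q) =
        (- Q) ^ n * ((- Q) ^ (n + 1) * lucas_U (p - 1 - m) P Q)"
    proof -
      \<comment> \<open>The sign comes from \<open>m = 2n+1\<close> being odd.\<close>
      have "(- Q) ^ n * (- Q) ^ (n + 1) = - (Q ^ m)"
        unfolding power_add[symmetric] m_def by (simp add: mult_2[symmetric])
      then show ?thesis by (simp only: mult.assoc[symmetric] minus_mult_left)
    qed
    ultimately have "rat_cong p (lucas_U m P Q) ((- Q) ^ n * ((- Q) ^ (n + 1) * lucas_U (p - 1 - m) P Q))"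
      using rat_cong_sym[OF assms(1)] by metis
    with S have "rat_cong p ((- Q) ^ n * S) ((- Q) ^ n * ((- Q) ^ (n + 1) * lucas_U (p - 1 - m) P Q))"
      using assms(1) by (rule rat_cong_trans)
    then show ?thesis
      by (rule cancel_Q_power)
  qed
  moreover have "rat_cong p S (- ((- Q) ^ n) * lucas_U (p + 1 - m) P Q)"
    if "rat_Legendre (P\<^sup>2 - 4 * Q) p = - 1"
  proof -
    have Up: "rat_cong p (lucas_U p P Q) (- 1)"
      and U1: "rat_cong p (2 * lucas_U (Suc p) P Q) (2 * 0)"
      using UL unfolding that by simp_all
    from U1 have U0: "rat_cong p (lucas_U (Suc p) P Q) 0"
      by (rule cancel_2)
    \<comment> \<open>Here the zero sits at index \<open>p+1\<close>, so d'Ocagne's identity needs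
      the next term, at index \<open>p+2\<close>.\<close>
    then have "rat_cong p (P * lucas_U (Suc p) P Q - Q * lucas_U p P Q) (P * 0 - Q * (- 1))"
      using Up P Q by (intro rat_cong_diff rat_cong_mult rat_cong_refl) auto
    then have U2: "rat_cong p (lucas_U (Suc (Suc p)) P Q) Q" by simp
    have "Q ^ m * lucas_U (p + 1 - m) P Q =
        lucas_U (Suc p) P Q * lucas_U (Suc m) P Q - lucas_U (Suc (Suc p)) P Q * lucas_U m P Q"
      using lucas_U_d_Ocagne[of Q m "p + 1 - m" P] le by simp
    also have "rat_cong p \<dots> (0 * lucas_U (Suc m) P Q - Q * lucas_U m P Q)"
      using U2 U0 U by (intro rat_cong_diff rat_cong_mult rat_cong_refl) auto
    finally have "rat_cong p (- (Q ^ m * lucas_U (p + 1 - m) P Q)) (Q * lucas_U m P Q)"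
      using rat_cong_uminus[of p _ "- (Q * lucas_U m P Q)"] by simp
    \<comment> \<open>One \<open>Q\<close> is split off \<open>Q ^ m\<close> to cancel the
      \<open>Q\<close> contributed by \<open>U2\<close>; the even power left over is
      \<open>(- Q) ^ n\<close> squared.\<close>
    moreover have "- (Q ^ m * lucas_U (p + 1 - m) P Q) =
        Q * ((- Q) ^ n * (- ((- Q) ^ n) * lucas_U (p + 1 - m) P Q))"
    proof -
      have "(- Q) ^ n * (- Q) ^ n = Q ^ (2 * n)"
        unfolding power_add[symmetric] by (simp add: mult_2[symmetric])
      then show ?thesis by (simp add: m_def mult.assoc[symmetric])
    qed
    ultimately have "rat_cong p ((- Q) ^ n * (- ((- Q) ^ n) * lucas_U (p + 1 - m) P Q)) (lucas_U m P Q)"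
      using cancel_Q by metis
    then have "rat_cong p (lucas_U m P Q) ((- Q) ^ n * (- ((- Q) ^ n) * lucas_U (p + 1 - m) P Q))"
      by (rule rat_cong_sym[OF assms(1)])
    with S have "rat_cong p ((- Q) ^ n * S) ((- Q) ^ n * (- ((- Q) ^ n) * lucas_U (p + 1 - m) P Q))"
      using assms(1) by (rule rat_cong_trans)
    then show ?thesis
      by (rule cancel_Q_power)
  qed
  ultimately show ?thesis
    unfolding D idx1 idx2 by (simp add: S_def n_def P_def Q_def)
qed

end
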